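(* Let $G$ be a group defined by a finite extension, i.e. suppose there is a short exact sequence of groups $$1\longrightarrow K\longrightarrow G\longrightarrow Q\longrightarrow 1$$ with $Q$ finite, and let $\theta : Q\longrightarrow \mathrm{Out}(K)$ be the natural homomorphism induced by conjugation in $G$. Then $G$ is icc if and only if $K$ is icc and $\theta$ is injective.
   Context: A group is said to be icc (with infinite conjugacy classes) if it is non-trivial and all its conjugacy classes except $\{1\}$ are infinite. In the exact sequence, $K$ is identified with its image, a normal subgroup of $G$, and $Q$ with $G/K$. For $g\in G$ let $\pi(g)\in \mathrm{Aut}(K)$ be the automorphism $k\mapsto k^g=g^{-1}kg$. With automorphisms composed left to right, $\pi: G\to\mathrm{Aut}(K)$ is a homomorphism sending $K$ onto $\mathrm{Inn}(K)$. The natural homomorphism $\theta: Q\to \mathrm{Out}(K)=\mathrm{Aut}(K)/\mathrm{Inn}(K)$ is the induced one: $\theta(gK)$ is the class of $\pi(g)$ modulo $\mathrm{Inn}(K)$. (Using $k\mapsto gkg^{-1}$ with the usual composition instead does not change whether $\theta$ is injective.) *)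

theory Defs
  imports "HOL-Algebra.Algebra"
begin

definition conjugation :: "('a, 'm) monoid_scheme \<Rightarrow> 'a \<Rightarrow> 'a \<Rightarrow> 'a"
  where "conjugation G g = (\<lambda>x \<in> carrier G. g \<otimes>\<^bsub>G\<^esub> x \<otimes>\<^bsub>G\<^esub> inv\<^bsub>G\<^esub> g)"

definition conjugacy_class :: "('a, 'm) monoid_scheme \<Rightarrow> 'a \<Rightarrow> 'a set"
  where "conjugacy_class G x = orbit G (conjugation G) x"

definition icc :: "('a, 'm) monoid_scheme \<Rightarrow> bool"
  where "icc G \<longleftrightarrow> carrier G \<noteq> {\<one>\<^bsub>G\<^esub>} \<and>
    (\<forall>x \<in> carrier G. x \<noteq> \<one>\<^bsub>G\<^esub> \<longrightarrow> infinite (conjugacy_class G x))"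

definition Inn :: "('a, 'm) monoid_scheme \<Rightarrow> ('a \<Rightarrow> 'a) set"
  where "Inn K = conjugation K ` carrier K"

definition Out :: "('a, 'm) monoid_scheme \<Rightarrow> ('a \<Rightarrow> 'a) set monoid"
  where "Out K = AutoGroup K Mod Inn K"

text \<open>
  For an extension \<open>1 \<rightarrow> K \<rightarrow> G \<rightarrow> Q \<rightarrow> 1\<close> with maps \<open>i\<close> and \<open>p\<close>, an element \<open>g\<close> of \<open>G\<close> acts
  on \<open>K\<close> through its identification with \<open>i ` carrier K\<close>. Since \<open>AutoGroup\<close> composes maps
  right to left, \<open>g\<close> acts by \<open>k \<mapsto> g k g\<^sup>-\<^sup>1\<close>; with \<open>k \<mapsto> g\<^sup>-\<^sup>1 k g\<close> the induced map on \<open>Q\<close> would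
  be the present one precomposed with inversion.
\<close>

definition kernel_conj ::
    "('k, 'l) monoid_scheme \<Rightarrow> ('g, 'm) monoid_scheme \<Rightarrow> ('k \<Rightarrow> 'g) \<Rightarrow> 'g \<Rightarrow> 'k \<Rightarrow> 'k"
  where "kernel_conj K G i g =
    (\<lambda>k \<in> carrier K. inv_into (carrier K) i (conjugation G g (i k)))"

text \<open>
  The image below is a singleton for \<open>q \<in> carrier Q\<close>: the class of the automorphism does not
  depend on the lift \<open>g\<close> of \<open>q\<close> (see \<open>outer_action_eq\<close>).
\<close>

definition outer_action ::
    "('k, 'l) monoid_scheme \<Rightarrow> ('g, 'm) monoid_scheme \<Rightarrow> ('k \<Rightarrow> 'g) \<Rightarrow> ('g \<Rightarrow> 'q) \<Rightarrow> 'q \<Rightarrow> ('k \<Rightarrow> 'k) set"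
  where "outer_action K G i p q =
    the_elem ((\<lambda>g. Inn K #>\<^bsub>AutoGroup K\<^esub> kernel_conj K G i g) ` {g \<in> carrier G. p g = q})"

lemma carrier_AutoGroup: "carrier (AutoGroup K) = auto K"
  by (simp add: AutoGroup_def)

lemma mult_AutoGroup:
  assumes "f \<in> auto K" "h \<in> auto K"
  shows "f \<otimes>\<^bsub>AutoGroup K\<^esub> h = compose (carrier K) f h"
  using assms by (simp add: AutoGroup_def BijGroup_def auto_def)

context group
begin

lemma conjugate_mult:
  assumes "g \<in> carrier G" "x \<in> carrier G" "y \<in> carrier G"
  shows "g \<otimes> (x \<otimes> y) \<otimes> inv g = g \<otimes> x \<otimes> inv g \<otimes> (g \<otimes> y \<otimes> inv g)"
proof -
  have "inv g \<otimes> (g \<otimes> z) = z" if "z \<in> carrier G" for z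
    using assms(1) that by (simp flip: m_assoc)
  thus ?thesis using assms by (simp add: m_assoc)
qed

lemma conjugation_in_auto:
  assumes g: "g \<in> carrier G"
  shows "conjugation G g \<in> auto G"
proof -
  have "conjugation G g \<in> Bij (carrier G)"
    using conjugation_is_bij[OF g] by (simp add: Bij_def conjugation_def)
  moreover have "conjugation G g \<in> hom G G"
    using g by (auto simp: hom_def conjugation_def conjugate_mult)
  ultimately show ?thesis by (simp add: auto_def)
qed

lemma conjugation_hom: "group_hom G (AutoGroup G) (conjugation G)"
proof (intro group_hom.intro group_hom_axioms.intro AutoGroup)
  show "group G" ..
  have "conjugation G (g \<otimes> h) = compose (carrier G) (conjugation G g) (conjugation G h)"
    if "g \<in> carrier G" "h \<in> carrier G" for g h
    using that by (auto simp: conjugation_def compose_def m_assoc inv_mult_group)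
  thus "conjugation G \<in> hom G (AutoGroup G)"
    by (auto simp: hom_def carrier_AutoGroup conjugation_in_auto mult_AutoGroup)
qed

lemma Inn_normal: "Inn G \<lhd> AutoGroup G"
proof -
  interpret A: group "AutoGroup G" by (rule AutoGroup)
  interpret c: group_hom G "AutoGroup G" "conjugation G" by (rule conjugation_hom)
  have sub: "subgroup (Inn G) (AutoGroup G)"
    unfolding Inn_def by (rule c.img_is_subgroup)
  have "f \<otimes>\<^bsub>AutoGroup G\<^esub> h \<otimes>\<^bsub>AutoGroup G\<^esub> inv\<^bsub>AutoGroup G\<^esub> f \<in> Inn G"
    if f: "f \<in> carrier (AutoGroup G)" and h: "h \<in> Inn G" for f h
  proof -
    obtain a where a: "a \<in> carrier G" "h = conjugation G a" using h by (auto simp: Inn_def)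
    have fa: "f \<in> auto G" using f by (simp add: carrier_AutoGroup)
    interpret f: group_hom G G f
      using fa by unfold_locales (simp add: auto_def)
    have "f \<otimes>\<^bsub>AutoGroup G\<^esub> h = conjugation G (f a) \<otimes>\<^bsub>AutoGroup G\<^esub> f"
      using a fa unfolding a(2)
      by (subst (1 2) mult_AutoGroup)
        (simp_all add: conjugation_in_auto, auto simp: compose_def conjugation_def fun_eq_iff)
    hence "f \<otimes>\<^bsub>AutoGroup G\<^esub> h \<otimes>\<^bsub>AutoGroup G\<^esub> inv\<^bsub>AutoGroup G\<^esub> f = conjugation G (f a)"
      using f a by (simp add: A.m_assoc)
    thus ?thesis using a by (simp add: Inn_def)
  qed
  thus ?thesis using sub by (simp add: A.normal_inv_iff)
qed

end

context
  fixes K :: "('k, 'l) monoid_scheme" and G :: "('g, 'm) monoid_scheme"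
    and Q :: "('q, 'n) monoid_scheme" and i :: "'k \<Rightarrow> 'g" and p :: "'g \<Rightarrow> 'q"
  assumes K: "group K" and G: "group G" and Q: "group Q"
    and i: "i \<in> mon K G" and p: "p \<in> epi G Q"
    and exact: "i ` carrier K = kernel G Q p"
begin

interpretation K: group K by (rule K)
interpretation G: group G by (rule G)
interpretation Q: group Q by (rule Q)
interpretation A: group "AutoGroup K" by (rule K.AutoGroup)
interpretation i: group_hom K G i using i by unfold_locales (simp add: mon_def)
interpretation p: group_hom G Q p using p by unfold_locales (simp add: epi_def)

lemma i_kernel_conj:
  assumes g: "g \<in> carrier G" and k: "k \<in> carrier K"
  shows "kernel_conj K G i g k \<in> carrier K"
    and "i (kernel_conj K G i g k) = g \<otimes>\<^bsub>G\<^esub> i k \<otimes>\<^bsub>G\<^esub> inv\<^bsub>G\<^esub> g"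
proof -
  have "i k \<in> kernel G Q p" using k exact by blast
  hence "g \<otimes>\<^bsub>G\<^esub> i k \<otimes>\<^bsub>G\<^esub> inv\<^bsub>G\<^esub> g \<in> i ` carrier K"
    using g k unfolding exact by (simp add: kernel_def)
  thus "kernel_conj K G i g k \<in> carrier K"
    and "i (kernel_conj K G i g k) = g \<otimes>\<^bsub>G\<^esub> i k \<otimes>\<^bsub>G\<^esub> inv\<^bsub>G\<^esub> g"
    using k by (simp_all add: kernel_conj_def conjugation_def inv_into_into f_inv_into_f)
qed

lemma kernel_conj_eqI:
  assumes "g \<in> carrier G" "k \<in> carrier K" "y \<in> carrier K"
    and "i y = g \<otimes>\<^bsub>G\<^esub> i k \<otimes>\<^bsub>G\<^esub> inv\<^bsub>G\<^esub> g"
  shows "kernel_conj K G i g k = y"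
  using i_kernel_conj[OF assms(1,2)] assms i by (metis (no_types, lifting) inj_onD mem_Collect_eq mon_def)

lemma kernel_conj_mult:
  assumes g: "g \<in> carrier G" and h: "h \<in> carrier G"
  shows "kernel_conj K G i (g \<otimes>\<^bsub>G\<^esub> h) =
    compose (carrier K) (kernel_conj K G i g) (kernel_conj K G i h)"
proof (rule extensionalityI[where A = "carrier K"])
  fix k assume k: "k \<in> carrier K"
  show "kernel_conj K G i (g \<otimes>\<^bsub>G\<^esub> h) k =
      compose (carrier K) (kernel_conj K G i g) (kernel_conj K G i h) k"
    using g h k
    by (intro kernel_conj_eqI) (auto simp: compose_def i_kernel_conj G.m_assoc G.inv_mult_group)
qed (auto simp: kernel_conj_def compose_def)

lemma kernel_conj_in_auto:
  assumes g: "g \<in> carrier G"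
  shows "kernel_conj K G i g \<in> auto K"
proof -
  have one: "kernel_conj K G i \<one>\<^bsub>G\<^esub> k = k" if "k \<in> carrier K" for k
    using that by (intro kernel_conj_eqI) auto
  have "kernel_conj K G i h (kernel_conj K G i (inv\<^bsub>G\<^esub> h) k) = k"
    if "k \<in> carrier K" "h \<in> carrier G" for k h
    using fun_cong[OF kernel_conj_mult[of h "inv\<^bsub>G\<^esub> h"], of k] that one
    by (simp add: compose_def)
  from this[of _ g] this[of _ "inv\<^bsub>G\<^esub> g"]
  have "bij_betw (kernel_conj K G i g) (carrier K) (carrier K)"
    using g i_kernel_conj(1) by (intro bij_betwI[where g = "kernel_conj K G i (inv\<^bsub>G\<^esub> g)"]) auto
  moreover have "kernel_conj K G i g (x \<otimes>\<^bsub>K\<^esub> y) = kernel_conj K G i g x \<otimes>\<^bsub>K\<^esub> kernel_conj K G i g y"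
    if x: "x \<in> carrier K" and y: "y \<in> carrier K" for x y
  proof -
    have "g \<otimes>\<^bsub>G\<^esub> (i x \<otimes>\<^bsub>G\<^esub> i y) \<otimes>\<^bsub>G\<^esub> inv\<^bsub>G\<^esub> g =
        g \<otimes>\<^bsub>G\<^esub> i x \<otimes>\<^bsub>G\<^esub> inv\<^bsub>G\<^esub> g \<otimes>\<^bsub>G\<^esub> (g \<otimes>\<^bsub>G\<^esub> i y \<otimes>\<^bsub>G\<^esub> inv\<^bsub>G\<^esub> g)"
      using g x y by (intro G.conjugate_mult) auto
    thus ?thesis using g x y by (intro kernel_conj_eqI) (auto simp: i_kernel_conj)
  qed
  hence "kernel_conj K G i g \<in> hom K K" using g i_kernel_conj(1) by (auto simp: hom_def)
  ultimately show ?thesis by (auto simp: auto_def Bij_def kernel_conj_def)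
qed

lemma kernel_conj_image:
  assumes "a \<in> carrier K"
  shows "kernel_conj K G i (i a) = conjugation K a"
proof (rule extensionalityI[where A = "carrier K"])
  fix k assume "k \<in> carrier K"
  thus "kernel_conj K G i (i a) k = conjugation K a k"
    using assms by (intro kernel_conj_eqI) (auto simp: conjugation_def)
qed (auto simp: kernel_conj_def conjugation_def)

lemma kernel_conj_hom: "kernel_conj K G i \<in> hom G (AutoGroup K)"
  by (auto simp: hom_def carrier_AutoGroup kernel_conj_in_auto mult_AutoGroup kernel_conj_mult)

lemma outer_action_eq:
  assumes g: "g \<in> carrier G"
  shows "outer_action K G i p (p g) = Inn K #>\<^bsub>AutoGroup K\<^esub> kernel_conj K G i g"
proof -
  interpret N: normal "Inn K" "AutoGroup K" by (rule K.Inn_normal)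
  have "Inn K #>\<^bsub>AutoGroup K\<^esub> kernel_conj K G i h = Inn K #>\<^bsub>AutoGroup K\<^esub> kernel_conj K G i g"
    if h: "h \<in> carrier G" "p h = p g" for h
  proof -
    have "h \<otimes>\<^bsub>G\<^esub> inv\<^bsub>G\<^esub> g \<in> kernel G Q p" using g h by (simp add: kernel_def)
    then obtain a where a: "a \<in> carrier K" "h \<otimes>\<^bsub>G\<^esub> inv\<^bsub>G\<^esub> g = i a" using exact by (metis imageE)
    hence "h = i a \<otimes>\<^bsub>G\<^esub> g" using g h by (metis G.inv_solve_right' G.inv_closed G.m_closed)
    hence "kernel_conj K G i h = conjugation K a \<otimes>\<^bsub>AutoGroup K\<^esub> kernel_conj K G i g"
      using a(1) g by (simp add: kernel_conj_mult kernel_conj_image mult_AutoGroup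
          kernel_conj_in_auto K.conjugation_in_auto)
    hence "kernel_conj K G i h \<in> Inn K #>\<^bsub>AutoGroup K\<^esub> kernel_conj K G i g"
      using a(1) by (auto simp: Inn_def r_coset_def)
    thus ?thesis
      using A.repr_independence[OF _ _ N.subgroup_axioms] g
      by (simp add: kernel_conj_in_auto carrier_AutoGroup)
  qed
  hence "\<forall>h \<in> {h \<in> carrier G. p h = p g}.
      Inn K #>\<^bsub>AutoGroup K\<^esub> kernel_conj K G i h = Inn K #>\<^bsub>AutoGroup K\<^esub> kernel_conj K G i g"
    by blast
  moreover have "g \<in> {h \<in> carrier G. p h = p g}" using g by blast
  ultimately have "(\<lambda>g. Inn K #>\<^bsub>AutoGroup K\<^esub> kernel_conj K G i g) ` {h \<in> carrier G. p h = p g} =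
      {Inn K #>\<^bsub>AutoGroup K\<^esub> kernel_conj K G i g}"
    by blast
  thus ?thesis by (simp add: outer_action_def)
qed

lemma outer_action_hom: "outer_action K G i p \<in> hom Q (Out K)"
proof (rule homI)
  interpret N: normal "Inn K" "AutoGroup K" by (rule K.Inn_normal)
  have lift: "\<exists>g \<in> carrier G. p g = q" if "q \<in> carrier Q" for q
  proof -
    have "q \<in> p ` carrier G" using p that by (simp add: epi_def)
    thus ?thesis by blast
  qed
  have kc: "kernel_conj K G i g \<in> carrier (AutoGroup K)" if "g \<in> carrier G" for g
    using that by (simp add: carrier_AutoGroup kernel_conj_in_auto)
  show "outer_action K G i p q \<in> carrier (Out K)" if q: "q \<in> carrier Q" for q
    using lift[OF q] kc by (auto simp: outer_action_eq Out_def FactGroup_def RCOSETS_def)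
  show "outer_action K G i p (q \<otimes>\<^bsub>Q\<^esub> r) =
      outer_action K G i p q \<otimes>\<^bsub>Out K\<^esub> outer_action K G i p r"
    if q: "q \<in> carrier Q" and r: "r \<in> carrier Q" for q r
  proof -
    obtain g h where gh: "g \<in> carrier G" "p g = q" "h \<in> carrier G" "p h = r"
      using lift q r by metis
    hence "outer_action K G i p (q \<otimes>\<^bsub>Q\<^esub> r) = Inn K #>\<^bsub>AutoGroup K\<^esub> kernel_conj K G i (g \<otimes>\<^bsub>G\<^esub> h)"
      using outer_action_eq[of "g \<otimes>\<^bsub>G\<^esub> h"] by simp
    also have "\<dots> = Inn K #>\<^bsub>AutoGroup K\<^esub> (kernel_conj K G i g \<otimes>\<^bsub>AutoGroup K\<^esub> kernel_conj K G i h)"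
      using gh by (simp add: hom_mult[OF kernel_conj_hom])
    also have "\<dots> = outer_action K G i p q \<otimes>\<^bsub>Out K\<^esub> outer_action K G i p r"
      using gh kc outer_action_eq by (auto simp: Out_def FactGroup_def N.rcos_sum)
    finally show ?thesis .
  qed
qed

end

end

theory Submission
  imports Defs
begin

text \<open>
  If \<open>g\<close> has a finite class in \<open>G\<close> then so does every commutator \<open>k g k\<^sup>-\<^sup>1 g\<^sup>-\<^sup>1\<close> with \<open>k \<in> K\<close>; it
  lies in \<open>K\<close>, so it is trivial when \<open>K\<close> is icc. Hence \<open>g\<close> centralizes \<open>K\<close>, and the injectivity of
  \<open>\<theta>\<close> puts \<open>g\<close> into \<open>K\<close>. Conversely, \<open>K\<close> has finite index, so an element whose orbit under
  conjugation by \<open>K\<close> is finite has a finite class in \<open>G\<close>. This applies to the elements of \<open>K\<close> with a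
  finite class in \<open>K\<close>, and to the elements that centralize \<open>K\<close>; if \<open>\<theta> (p g)\<close> is trivial, then
  \<open>g\<close> differs from an element of the second kind by an element of \<open>K\<close>.
\<close>

context group
begin

lemma conjugacy_class_eq_image:
  "x \<in> carrier G \<Longrightarrow> conjugacy_class G x = (\<lambda>g. g \<otimes> x \<otimes> inv g) ` carrier G"
  by (auto simp: conjugacy_class_def orbit_def conjugation_def)

lemma conjugate_conjugate:
  assumes "g \<in> carrier G" "h \<in> carrier G" "x \<in> carrier G"
  shows "g \<otimes> (h \<otimes> x \<otimes> inv h) \<otimes> inv g = (g \<otimes> h) \<otimes> x \<otimes> inv (g \<otimes> h)"
  using assms by (simp add: m_assoc inv_mult_group)

lemma conjugate_eq_self_iff:
  assumes "g \<in> carrier G" "x \<in> carrier G"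
  shows "g \<otimes> x \<otimes> inv g = x \<longleftrightarrow> g \<otimes> x = x \<otimes> g"
  using assms inv_solve_right'[of x "g \<otimes> x" g] by auto

text \<open>Together with the next two lemmas this gives the closure properties of the FC-centre,
  the normal subgroup of elements with finite class, through which a commutator inherits
  finiteness.\<close>

lemma finite_conjugacy_class_mult:
  assumes "x \<in> carrier G" "y \<in> carrier G"
    and "finite (conjugacy_class G x)" "finite (conjugacy_class G y)"
  shows "finite (conjugacy_class G (x \<otimes> y))"
proof (rule finite_subset)
  show "conjugacy_class G (x \<otimes> y) \<subseteq>
      (\<lambda>(a, b). a \<otimes> b) ` (conjugacy_class G x \<times> conjugacy_class G y)"
    using assms(1,2) by (fastforce simp: conjugacy_class_eq_image conjugate_mult)
qed (use assms in simp)

lemma finite_conjugacy_class_inv: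
  assumes "x \<in> carrier G" "finite (conjugacy_class G x)"
  shows "finite (conjugacy_class G (inv x))"
proof (rule finite_subset)
  have "g \<otimes> inv x \<otimes> inv g = inv (g \<otimes> x \<otimes> inv g)" if "g \<in> carrier G" for g
    using that assms(1) by (simp add: inv_mult_group m_assoc)
  thus "conjugacy_class G (inv x) \<subseteq> (\<lambda>y. inv y) ` conjugacy_class G x"
    using assms(1) by (auto simp: conjugacy_class_eq_image)
qed (use assms in simp)

lemma finite_conjugacy_class_conjugate:
  assumes "x \<in> carrier G" "h \<in> carrier G" "finite (conjugacy_class G x)"
  shows "finite (conjugacy_class G (h \<otimes> x \<otimes> inv h))"
proof (rule finite_subset)
  show "conjugacy_class G (h \<otimes> x \<otimes> inv h) \<subseteq> conjugacy_class G x"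
    using assms(1,2) by (auto simp: conjugacy_class_eq_image conjugate_conjugate)
qed (use assms in simp)

end

text \<open>The kernel has finite index: with \<open>s\<close> choosing preimages under
  \<open>h\<close>, every \<open>g\<close> is \<open>s (h g)\<close> times a kernel element, so
  finitely many conjugates of the kernel orbit cover the class. Outside the image of
  \<open>h\<close> the values of \<open>s\<close> are arbitrary, which only enlarges the covering
  set.\<close>

lemma (in group_hom) finite_conjugacy_class_if_finite_kernel_orbit:
  assumes fin: "finite (carrier H)" and x: "x \<in> carrier G"
    and orb: "finite ((\<lambda>n. n \<otimes> x \<otimes> inv n) ` kernel G H h)"
  shows "finite (conjugacy_class G x)"
proof (rule finite_subset)
  define s where "s = inv_into (carrier G) h"
  let ?S = "(\<lambda>n. n \<otimes> x \<otimes> inv n) ` kernel G H h"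
  show "conjugacy_class G x \<subseteq> (\<lambda>(q, y). s q \<otimes> y \<otimes> inv (s q)) ` (carrier H \<times> ?S)"
  proof
    fix y assume "y \<in> conjugacy_class G x"
    then obtain g where g: "g \<in> carrier G" "y = g \<otimes> x \<otimes> inv g"
      using x by (auto simp: G.conjugacy_class_eq_image)
    have s: "s (h g) \<in> carrier G" "h (s (h g)) = h g"
      using g(1) by (auto simp: s_def inv_into_into f_inv_into_f)
    define n where "n = inv (s (h g)) \<otimes> g"
    have n: "n \<in> kernel G H h" "g = s (h g) \<otimes> n"
      using g(1) s by (simp_all add: n_def kernel_def flip: G.m_assoc)
    have "n \<in> carrier G" using n(1) by (simp add: kernel_def)
    hence "y = s (h g) \<otimes> (n \<otimes> x \<otimes> inv n) \<otimes> inv (s (h g))"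
      using g(2) n(2) s x by (metis G.conjugate_conjugate)
    thus "y \<in> (\<lambda>(q, y). s q \<otimes> y \<otimes> inv (s q)) ` (carrier H \<times> ?S)"
      using n(1) g(1) by force
  qed
qed (use fin orb in simp)

text \<open>Applied to \<open>i\<close>, this turns classes of \<open>K\<close> into orbits under
  \<open>kernel G Q p\<close>.\<close>

lemma (in group_hom) conjugacy_class_image:
  assumes "x \<in> carrier G"
  shows "h ` conjugacy_class G x = (\<lambda>n. n \<otimes>\<^bsub>H\<^esub> h x \<otimes>\<^bsub>H\<^esub> inv\<^bsub>H\<^esub> n) ` (h ` carrier G)"
  using assms by (auto simp: G.conjugacy_class_eq_image image_image)

theorem mainTheorem1:
  fixes K :: "('k, 'l) monoid_scheme" and G :: "('g, 'm) monoid_scheme"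
    and Q :: "('q, 'n) monoid_scheme" and i :: "'k \<Rightarrow> 'g" and p :: "'g \<Rightarrow> 'q"
  assumes "group K" and "group G" and "group Q"
    and "i \<in> mon K G" and "p \<in> epi G Q"
    and "i ` carrier K = kernel G Q p"
    and "finite (carrier Q)"
  shows "icc G \<longleftrightarrow> icc K \<and> inj_on (outer_action K G i p) (carrier Q)"
proof -
  note ext = assms(1-6)
  interpret K: group K by fact
  interpret G: group G by fact
  interpret Q: group Q by fact
  interpret i: group_hom K G i using assms(4) by unfold_locales (simp add: mon_def)
  interpret p: group_hom G Q p using assms(5) by unfold_locales (simp add: epi_def)
  interpret A: group "AutoGroup K" by (rule K.AutoGroup)
  interpret N: normal "Inn K" "AutoGroup K" by (rule K.Inn_normal)
  interpret \<theta>: group_hom Q "Out K" "outer_action K G i p"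
  proof (intro group_hom.intro group_hom_axioms.intro)
    show "group (Out K)" unfolding Out_def by (rule N.factorgroup_is_group)
    show "outer_action K G i p \<in> hom Q (Out K)" by (rule outer_action_hom[OF ext])
  qed fact
  have inj: "inj_on i (carrier K)" using assms(4) by (simp add: mon_def)
  have one: "i k = \<one>\<^bsub>G\<^esub> \<longleftrightarrow> k = \<one>\<^bsub>K\<^esub>" if "k \<in> carrier K" for k
    using inj that by (metis K.one_closed i.hom_one inj_onD)
  have fin_iff: "finite (conjugacy_class K k) \<longleftrightarrow>
      finite ((\<lambda>n. n \<otimes>\<^bsub>G\<^esub> i k \<otimes>\<^bsub>G\<^esub> inv\<^bsub>G\<^esub> n) ` kernel G Q p)" if k: "k \<in> carrier K" for k
  proof -
    have "conjugacy_class K k \<subseteq> carrier K" using k by (auto simp: K.conjugacy_class_eq_image)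
    hence "inj_on i (conjugacy_class K k)" using inj by (rule inj_on_subset[rotated])
    thus ?thesis using i.conjugacy_class_image[OF k] assms(6) by (metis finite_image_iff)
  qed
  \<comment> \<open>The identity of \<open>Out K\<close> is the coset \<open>Inn K\<close>
    itself.\<close>
  have trivial_iff: "outer_action K G i p (p g) = \<one>\<^bsub>Out K\<^esub> \<longleftrightarrow> kernel_conj K G i g \<in> Inn K"
    if g: "g \<in> carrier G" for g
  proof -
    have c: "kernel_conj K G i g \<in> carrier (AutoGroup K)"
      using kernel_conj_in_auto[OF ext g] by (simp add: carrier_AutoGroup)
    have "Inn K #>\<^bsub>AutoGroup K\<^esub> kernel_conj K G i g = Inn K \<longleftrightarrow> kernel_conj K G i g \<in> Inn K"
      using c A.coset_join1[OF _ c N.subgroup_axioms]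
        A.coset_join2[OF c N.subgroup_axioms] by blast
    thus ?thesis by (simp add: outer_action_eq[OF ext g] Out_def)
  qed
  show ?thesis
  proof
    assume G: "icc G"
    \<comment> \<open>Here \<open>x\<close> ranges over all of \<open>G\<close>: beyond the image of
      \<open>K\<close>, the bound is also needed for elements centralizing it.\<close>
    have small: "x = \<one>\<^bsub>G\<^esub>" if "x \<in> carrier G"
      "finite ((\<lambda>n. n \<otimes>\<^bsub>G\<^esub> x \<otimes>\<^bsub>G\<^esub> inv\<^bsub>G\<^esub> n) ` kernel G Q p)" for x
      using G that p.finite_conjugacy_class_if_finite_kernel_orbit[OF assms(7)]
      unfolding icc_def by blast
    have "carrier K \<noteq> {\<one>\<^bsub>K\<^esub>}"
    proof
      assume "carrier K = {\<one>\<^bsub>K\<^esub>}"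
      \<comment> \<open>A finite kernel has only finite orbits, so \<open>small\<close> would
        collapse \<open>G\<close>.\<close>
      hence "finite (kernel G Q p)" by (simp flip: assms(6))
      hence "carrier G \<subseteq> {\<one>\<^bsub>G\<^esub>}" using small by blast
      thus False using G unfolding icc_def by blast
    qed
    hence "icc K" using small fin_iff one unfolding icc_def by (metis i.hom_closed)
    moreover have "q = \<one>\<^bsub>Q\<^esub>" if q: "q \<in> carrier Q" "outer_action K G i p q = \<one>\<^bsub>Out K\<^esub>" for q
    proof -
      have "q \<in> p ` carrier G" using assms(5) q(1) by (simp add: epi_def)
      then obtain g where g: "g \<in> carrier G" "q = p g" by blast
      obtain a where a: "a \<in> carrier K" "kernel_conj K G i g = conjugation K a"
        using q(2) g trivial_iff unfolding Inn_def by blast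
      \<comment> \<open>Since \<open>g\<close> and \<open>i a\<close> induce the same automorphism
        of \<open>K\<close>, their quotient \<open>z\<close> centralizes the kernel.\<close>
      define z where "z = inv\<^bsub>G\<^esub> (i a) \<otimes>\<^bsub>G\<^esub> g"
      have z: "z \<in> carrier G" "g = i a \<otimes>\<^bsub>G\<^esub> z"
        using a(1) g(1) by (simp_all add: z_def flip: G.m_assoc)
      have comm: "n \<otimes>\<^bsub>G\<^esub> z \<otimes>\<^bsub>G\<^esub> inv\<^bsub>G\<^esub> n = z" if n: "n \<in> kernel G Q p" for n
      proof -
        obtain k where k: "k \<in> carrier K" "n = i k" using n assms(6) by blast
        \<comment> \<open>Conjugation by \<open>g\<close> is computed twice, once through
          \<open>g = i a z\<close> and once through the choice of \<open>a\<close>; cancelling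
          \<open>i a\<close> leaves the action of \<open>z\<close>.\<close>
        have "i a \<otimes>\<^bsub>G\<^esub> (z \<otimes>\<^bsub>G\<^esub> i k \<otimes>\<^bsub>G\<^esub> inv\<^bsub>G\<^esub> z) \<otimes>\<^bsub>G\<^esub> inv\<^bsub>G\<^esub> (i a) = g \<otimes>\<^bsub>G\<^esub> i k \<otimes>\<^bsub>G\<^esub> inv\<^bsub>G\<^esub> g"
          using a(1) k(1) z by (simp add: G.conjugate_conjugate)
        also have "\<dots> = i (conjugation K a k)"
          using i_kernel_conj(2)[OF ext g(1) k(1)] a(2) by simp
        also have "\<dots> = i a \<otimes>\<^bsub>G\<^esub> i k \<otimes>\<^bsub>G\<^esub> inv\<^bsub>G\<^esub> (i a)"
          using a(1) k(1) by (simp add: conjugation_def)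
        finally have "z \<otimes>\<^bsub>G\<^esub> i k \<otimes>\<^bsub>G\<^esub> inv\<^bsub>G\<^esub> z = i k" using a(1) k(1) z(1) by simp
        thus ?thesis using k z(1) by (simp add: G.conjugate_eq_self_iff)
      qed
      have "(\<lambda>n. n \<otimes>\<^bsub>G\<^esub> z \<otimes>\<^bsub>G\<^esub> inv\<^bsub>G\<^esub> n) ` kernel G Q p \<subseteq> {z}" using comm by blast
      hence "z = \<one>\<^bsub>G\<^esub>" using small[OF z(1)] finite_subset by blast
      hence "g \<in> kernel G Q p" using z(2) a(1) assms(6) by auto
      thus "q = \<one>\<^bsub>Q\<^esub>" using g(2) by (simp add: kernel_def)
    qed
    hence "inj_on (outer_action K G i p) (carrier Q)"
      by (simp add: \<theta>.inj_on_one_iff)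
    ultimately show "icc K \<and> inj_on (outer_action K G i p) (carrier Q)" by blast
  next
    assume R: "icc K \<and> inj_on (outer_action K G i p) (carrier Q)"
    have triv: "x = \<one>\<^bsub>G\<^esub>" if x: "x \<in> kernel G Q p" "finite (conjugacy_class G x)" for x
    proof -
      obtain k where k: "k \<in> carrier K" "x = i k" using x(1) assms(6) by blast
      have "(\<lambda>n. n \<otimes>\<^bsub>G\<^esub> x \<otimes>\<^bsub>G\<^esub> inv\<^bsub>G\<^esub> n) ` kernel G Q p \<subseteq> conjugacy_class G x"
        using x(1) by (auto simp: G.conjugacy_class_eq_image kernel_def)
      hence "finite (conjugacy_class K k)" using x(2) k fin_iff finite_subset by blast
      hence "k = \<one>\<^bsub>K\<^esub>" using R k(1) unfolding icc_def by blast
      thus ?thesis using k(2) by simp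
    qed
    have "g = \<one>\<^bsub>G\<^esub>" if g: "g \<in> carrier G" "finite (conjugacy_class G g)" for g
    proof -
      have "kernel_conj K G i g k = k" if k: "k \<in> carrier K" for k
      proof (rule kernel_conj_eqI[OF ext g(1) k k])
        \<comment> \<open>This commutator is a conjugate of \<open>g\<close> times the inverse of
          \<open>g\<close>, hence has a finite class; \<open>p\<close> sends it to the identity
          because it kills \<open>i k\<close>.\<close>
        let ?c = "i k \<otimes>\<^bsub>G\<^esub> g \<otimes>\<^bsub>G\<^esub> inv\<^bsub>G\<^esub> (i k) \<otimes>\<^bsub>G\<^esub> inv\<^bsub>G\<^esub> g"
        have "p (i k) = \<one>\<^bsub>Q\<^esub>" using k assms(6) by (auto simp: kernel_def)
        hence "?c \<in> kernel G Q p" using g(1) k by (simp add: kernel_def)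
        moreover have "finite (conjugacy_class G ?c)"
          using g k by (intro G.finite_conjugacy_class_mult G.finite_conjugacy_class_inv
              G.finite_conjugacy_class_conjugate) auto
        ultimately have "?c = \<one>\<^bsub>G\<^esub>" by (rule triv)
        hence "i k \<otimes>\<^bsub>G\<^esub> g \<otimes>\<^bsub>G\<^esub> inv\<^bsub>G\<^esub> (i k) = g"
          using g(1) k G.inv_equality[of _ "inv\<^bsub>G\<^esub> g"] by fastforce
        thus "i k = g \<otimes>\<^bsub>G\<^esub> i k \<otimes>\<^bsub>G\<^esub> inv\<^bsub>G\<^esub> g"
          using g(1) k G.conjugate_eq_self_iff i.hom_closed by metis
      qed
      \<comment> \<open>Both sides are restricted to \<open>carrier K\<close>, so agreement there
        gives equality of functions.\<close>
      hence "kernel_conj K G i g = conjugation K \<one>\<^bsub>K\<^esub>"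
        by (auto simp: kernel_conj_def conjugation_def fun_eq_iff)
      hence "kernel_conj K G i g \<in> Inn K" by (auto simp: Inn_def)
      \<comment> \<open>Injectivity of the outer action places \<open>g\<close> in the kernel, where
        \<open>triv\<close> applies to \<open>g\<close> itself.\<close>
      hence "p g = \<one>\<^bsub>Q\<^esub>" using R g(1) trivial_iff \<theta>.inj_on_one_iff p.hom_closed by metis
      thus ?thesis using triv g by (simp add: kernel_def)
    qed
    moreover have "carrier G \<noteq> {\<one>\<^bsub>G\<^esub>}"
    proof
      assume "carrier G = {\<one>\<^bsub>G\<^esub>}"
      hence "carrier K = {\<one>\<^bsub>K\<^esub>}" using one i.hom_closed by blast
      thus False using R unfolding icc_def by blast
    qed
    ultimately show "icc G" unfolding icc_def by blast
  qed
qed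

end
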